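(* Let $k\ge4$ be an even integer, $\eta>0$, $\beta_1\in[0,1)$, $\beta_2\in(0,1)$, and assume $\beta_2>\left(\frac{k-2}{k}\right)^{2(k-2)}$. Consider the three-dimensional discrete dynamical system with states $(\omega_t,\lambda_t,x_t)$, $\lambda_t\ge0$, $$\omega_{t+1}=\frac{\beta_1\omega_t}{(1-\eta\omega_t\lambda_t)^{k-1}}+1-\beta_1,\qquad \lambda_{t+1}=\frac{(1-\eta\omega_t\lambda_t)^{k-2}\lambda_t}{\sqrt{\beta_2+(1-\beta_2)(1-\eta\omega_t\lambda_t)^{2k-2}\lambda_t^2x_t^2}},\qquad x_{t+1}=(1-\eta\omega_t\lambda_t)x_t .$$ By the non-trivial fixed point we mean $$\omega^*=\frac{1-\beta_1}{1-\beta_1\beta_2^{-\frac{k-1}{2(k-2)}}},\qquad \lambda^*=\frac{1-\beta_2^{\frac{1}{2(k-2)}}}{\eta\,\omega^*},\qquad x^*=0,$$ which is said to exist when these formulas are well defined and $\lambda^*\ge0$. Then: (i) If $\beta_1>\beta_2^{\frac{k-1}{2(k-2)}}$, no non-trivial fixed point exists; the only fixed points (with $\lambda^*\ge 0$) are the trivial ones $(\omega^*,\lambda^*,x^* )=(1,0,c)$, $c\in\mathbb{R}$ an arbitrary constant. (ii) If $\beta_2^{\frac{k}{2(k-2)}}<\beta_1<\beta_2^{\frac{k-1}{2(k-2)}}$, the non-trivial fixed point exists but is asymptotically unstable. (iii) If $\beta_1<\beta_2^{\frac{k}{2(k-2)}}$, the non-trivial fixed point exists and is asymptotically stable.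
   Context: The system describes the Adam optimizer (with $\varepsilon=0$ and no bias correction) applied to $L(x)=\frac1kx^k$: $m_t=\beta_1m_{t-1}+(1-\beta_1)x_t^{k-1}$, $v_t=\beta_2v_{t-1}+(1-\beta_2)x_t^{2k-2}$, $x_{t+1}=x_t-\eta m_t/\sqrt{v_t}$, in the variables $\omega_t=m_t/x_t^{k-1}$ and $\lambda_t=x_t^{k-2}/\sqrt{v_t}$; hence only $\lambda\ge0$ is admissible. Stability notions are the usual ones for fixed points of discrete-time dynamical systems: a fixed point is asymptotically stable if it is Lyapunov stable and all trajectories starting sufficiently close to it converge to it; "asymptotically unstable" means unstable, i.e. not Lyapunov stable.
   Formalization: In (i), "the only fixed points are the trivial ones" is proved only among states with 1−ηωλ>0; without this it is false: for even k, x=0, 1−ηωλ=−β₂^{1/(2(k−2))} gives another fixed point with λ>0 for all admissible parameters. *)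

theory Defs
  imports "HOL-Analysis.Analysis"
begin

definition fixed_point_on :: "'a set \<Rightarrow> ('a \<Rightarrow> 'a) \<Rightarrow> 'a \<Rightarrow> bool" where
  "fixed_point_on S f p \<longleftrightarrow> p \<in> S \<and> f p = p"

definition lyapunov_stable_on :: "'a::metric_space set \<Rightarrow> ('a \<Rightarrow> 'a) \<Rightarrow> 'a \<Rightarrow> bool" where
  "lyapunov_stable_on S f p \<longleftrightarrow>
     (\<forall>\<epsilon>>0. \<exists>\<delta>>0. \<forall>q\<in>S. dist q p < \<delta> \<longrightarrow> (\<forall>n. dist ((f ^^ n) q) p < \<epsilon>))"

definition asymptotically_stable_on :: "'a::metric_space set \<Rightarrow> ('a \<Rightarrow> 'a) \<Rightarrow> 'a \<Rightarrow> bool" where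
  "asymptotically_stable_on S f p \<longleftrightarrow>
     fixed_point_on S f p \<and> lyapunov_stable_on S f p \<and>
     (\<exists>\<delta>>0. \<forall>q\<in>S. dist q p < \<delta> \<longrightarrow> (\<lambda>n. (f ^^ n) q) \<longlonglongrightarrow> p)"

definition unstable_on :: "'a::metric_space set \<Rightarrow> ('a \<Rightarrow> 'a) \<Rightarrow> 'a \<Rightarrow> bool" where
  "unstable_on S f p \<longleftrightarrow> fixed_point_on S f p \<and> \<not> lyapunov_stable_on S f p"

text \<open>
  States are triples of the rescaled momentum, the rescaled step size and the iterate.
  The recursion is undefined where the factor \<open>1 - \<eta> * \<omega> * l\<close> is zero, and there the
  convention \<open>x / 0 = 0\<close> supplies a value. This value plays no role: such a state is not
  a fixed point (it has \<open>l \<noteq> 0\<close> but its image has second component \<open>0\<close>), and at a fixed point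
  the factor is nonzero, so that it is nonzero in a whole neighbourhood; the two stability
  notions above depend on the map near the fixed point only.
\<close>

definition adam_states :: "(real \<times> real \<times> real) set" where
  "adam_states = {(\<omega>, l, x). 0 \<le> l}"

definition adam_step ::
  "nat \<Rightarrow> real \<Rightarrow> real \<Rightarrow> real \<Rightarrow> real \<times> real \<times> real \<Rightarrow> real \<times> real \<times> real" where
  "adam_step k \<eta> \<beta>\<^sub>1 \<beta>\<^sub>2 = (\<lambda>(\<omega>, l, x).
     (\<beta>\<^sub>1 * \<omega> / (1 - \<eta> * \<omega> * l) ^ (k - 1) + 1 - \<beta>\<^sub>1,
      (1 - \<eta> * \<omega> * l) ^ (k - 2) * l /
        sqrt (\<beta>\<^sub>2 + (1 - \<beta>\<^sub>2) * (1 - \<eta> * \<omega> * l) ^ (2 * k - 2) * l\<^sup>2 * x\<^sup>2),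
      (1 - \<eta> * \<omega> * l) * x))"

definition nontrivial_omega :: "nat \<Rightarrow> real \<Rightarrow> real \<Rightarrow> real" where
  "nontrivial_omega k \<beta>\<^sub>1 \<beta>\<^sub>2 =
     (1 - \<beta>\<^sub>1) / (1 - \<beta>\<^sub>1 * \<beta>\<^sub>2 powr (- ((real k - 1) / (2 * (real k - 2)))))"

definition nontrivial_lambda :: "nat \<Rightarrow> real \<Rightarrow> real \<Rightarrow> real \<Rightarrow> real" where
  "nontrivial_lambda k \<eta> \<beta>\<^sub>1 \<beta>\<^sub>2 =
     (1 - \<beta>\<^sub>2 powr (1 / (2 * (real k - 2)))) / (\<eta> * nontrivial_omega k \<beta>\<^sub>1 \<beta>\<^sub>2)"

definition nontrivial_point :: "nat \<Rightarrow> real \<Rightarrow> real \<Rightarrow> real \<Rightarrow> real \<times> real \<times> real" where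
  "nontrivial_point k \<eta> \<beta>\<^sub>1 \<beta>\<^sub>2 =
     (nontrivial_omega k \<beta>\<^sub>1 \<beta>\<^sub>2, nontrivial_lambda k \<eta> \<beta>\<^sub>1 \<beta>\<^sub>2, 0)"

text \<open>The first two conjuncts say that the denominators in the two formulas do not vanish.\<close>

definition nontrivial_exists :: "nat \<Rightarrow> real \<Rightarrow> real \<Rightarrow> real \<Rightarrow> bool" where
  "nontrivial_exists k \<eta> \<beta>\<^sub>1 \<beta>\<^sub>2 \<longleftrightarrow>
     1 - \<beta>\<^sub>1 * \<beta>\<^sub>2 powr (- ((real k - 1) / (2 * (real k - 2)))) \<noteq> 0 \<and>
     \<eta> * nontrivial_omega k \<beta>\<^sub>1 \<beta>\<^sub>2 \<noteq> 0 \<and>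
     0 \<le> nontrivial_lambda k \<eta> \<beta>\<^sub>1 \<beta>\<^sub>2"

text \<open>
  For even \<open>k\<close> the equation \<open>(1 - \<eta> * \<omega> * l) ^ (k - 2) = sqrt \<beta>\<^sub>2\<close>, which governs the fixed points
  with \<open>l > 0\<close> and \<open>x = 0\<close>, has a second, negative root \<open>1 - \<eta> * \<omega> * l\<close>. It yields, for all admissible
  parameters, a further fixed point, which is neither trivial nor the point \<open>nontrivial_point\<close>.
  For this reason an unrestricted claim that only the trivial points are fixed would be false;
  it has to be confined to states with \<open>0 < 1 - \<eta> * \<omega> * l\<close>.
\<close>

lemma sign_reversing_fixed_point:
  fixes k :: nat and \<eta> \<beta>\<^sub>1 \<beta>\<^sub>2 :: real
  assumes "even k" and "4 \<le> k" and "0 < \<eta>" and "0 \<le> \<beta>\<^sub>1" and "\<beta>\<^sub>1 < 1" and "0 < \<beta>\<^sub>2"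
  defines "s \<equiv> \<beta>\<^sub>2 powr (1 / (2 * (real k - 2)))"
  defines "\<omega> \<equiv> (1 - \<beta>\<^sub>1) / (1 + \<beta>\<^sub>1 / s ^ (k - 1))"
  defines "l \<equiv> (1 + s) / (\<eta> * \<omega>)"
  shows "0 < l" and "1 - \<eta> * \<omega> * l = - s"
    and "fixed_point_on adam_states (adam_step k \<eta> \<beta>\<^sub>1 \<beta>\<^sub>2) (\<omega>, l, 0)"
proof -
  have s: "0 < s" using \<open>0 < \<beta>\<^sub>2\<close> by (simp add: s_def)
  have D: "0 < 1 + \<beta>\<^sub>1 / s ^ (k - 1)"
    using s \<open>0 \<le> \<beta>\<^sub>1\<close> by (intro add_pos_nonneg) auto
  have w: "0 < \<omega>" unfolding \<omega>_def using D \<open>\<beta>\<^sub>1 < 1\<close> by (intro divide_pos_pos) auto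
  show l: "0 < l"
    unfolding l_def using s w \<open>0 < \<eta>\<close> by (intro divide_pos_pos mult_pos_pos) auto
  have "\<eta> * \<omega> * l = 1 + s" unfolding l_def using w \<open>0 < \<eta>\<close> by (simp del: mult_eq_0_iff)
  then show f: "1 - \<eta> * \<omega> * l = - s" by simp
  have "s ^ (k - 2) = s powr real (k - 2)" using s by (simp add: powr_realpow)
  also have "\<dots> = \<beta>\<^sub>2 powr (1 / (2 * (real k - 2)) * real (k - 2))"
    unfolding s_def by (rule powr_powr)
  also have "1 / (2 * (real k - 2)) * real (k - 2) = 1 / 2"
    using \<open>4 \<le> k\<close> by (simp add: of_nat_diff field_simps)
  finally have p: "(- s) ^ (k - 2) = sqrt \<beta>\<^sub>2"
    using \<open>even k\<close> \<open>4 \<le> k\<close> \<open>0 < \<beta>\<^sub>2\<close> by (simp add: powr_half_sqrt)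
  have o: "(- s) ^ (k - 1) = - (s ^ (k - 1))"
    using \<open>even k\<close> \<open>4 \<le> k\<close> by (intro power_minus_odd) simp
  have "\<omega> * (1 + \<beta>\<^sub>1 / s ^ (k - 1)) = 1 - \<beta>\<^sub>1" unfolding \<omega>_def using D by simp
  hence e: "\<beta>\<^sub>1 * \<omega> / (- (s ^ (k - 1))) + 1 - \<beta>\<^sub>1 = \<omega>" by (simp add: algebra_simps)
  have "adam_step k \<eta> \<beta>\<^sub>1 \<beta>\<^sub>2 (\<omega>, l, 0) = (\<omega>, l, 0)"
    unfolding adam_step_def prod.case f p o e using \<open>0 < \<beta>\<^sub>2\<close> by simp
  with l show "fixed_point_on adam_states (adam_step k \<eta> \<beta>\<^sub>1 \<beta>\<^sub>2) (\<omega>, l, 0)"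
    by (simp add: fixed_point_on_def adam_states_def)
qed

end

theory Submission
  imports Defs
begin

text \<open>
  Put \<open>m = k - 2\<close> and \<open>s = \<beta>\<^sub>2 powr (1 / (2 * m))\<close>, so that \<open>1 - \<eta> * \<omega> * l = s\<close> at the non-trivial
  fixed point. There the Jacobian is block diagonal: the entry \<open>s < 1\<close> for \<open>x\<close>, and a block for
  \<open>(\<omega>, l)\<close> with determinant \<open>D = \<beta>\<^sub>1 / s ^ k\<close> and trace \<open>T\<close> satisfying
  \<open>1 - T + D = m * (1 - s) * (1 / s - D)\<close> and \<open>1 + T + D = D * (m + 2 - m * s) + (m + 2 - m / s)\<close>.
  The lower bound on \<open>\<beta>\<^sub>2\<close> says \<open>s > m / (m + 2)\<close>, so \<open>\<bar>T\<bar> < 1 + D\<close> whenever \<open>\<beta>\<^sub>1 < s ^ (k - 1)\<close>, and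
  the block has both eigenvalues inside the unit disc if \<open>D < 1\<close> and both outside if \<open>D > 1\<close>.
  In either case an explicit quadratic form decreases strictly along the linearization; it is
  positive definite if \<open>D < 1\<close> and takes negative values if \<open>D > 1\<close>, so Lyapunov's direct method
  yields stability or instability of the non-linear system.
\<close>

section \<open>Lyapunov's direct method for a linearized map\<close>

text \<open>\<open>c\<close> is the minimum of \<open>W\<close> on the compact unit sphere, and
  homogeneity carries the bound to every vector. This minimum may be negative, so its positivity is
  a conditional conclusion and indefinite forms are covered too.\<close>

lemma homogeneous_lower_bound:
  fixes W :: "'a::euclidean_space \<Rightarrow> real"
  assumes cont: "continuous_on UNIV W" and hom: "\<And>t h. W (t *\<^sub>R h) = t\<^sup>2 * W h"
  obtains c where "\<And>h. c * (norm h)\<^sup>2 \<le> W h" and "(\<And>h. h \<noteq> 0 \<Longrightarrow> 0 < W h) \<Longrightarrow> 0 < c"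
proof -
  have "\<exists>x\<in>sphere 0 1. \<forall>y\<in>sphere (0::'a) 1. W x \<le> W y"
  proof (rule continuous_attains_inf)
    obtain b :: 'a where "b \<in> Basis" using nonempty_Basis by blast
    then have "b \<in> sphere 0 1" by simp
    then show "sphere (0::'a) 1 \<noteq> {}" by blast
  qed (use cont continuous_on_subset in auto)
  then obtain x :: 'a where x: "norm x = 1" and min: "\<And>y. norm y = 1 \<Longrightarrow> W x \<le> W y"
    by auto
  show ?thesis
  proof (rule that[of "W x"])
    fix h :: 'a
    show "W x * (norm h)\<^sup>2 \<le> W h"
    proof (cases "h = 0")
      case True
      then show ?thesis using hom[of 0 0] by simp
    next
      case False
      then have "W x \<le> W (h /\<^sub>R norm h)" by (intro min) simp
      also have "\<dots> = W h / (norm h)\<^sup>2" by (simp add: hom power_inverse divide_simps)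
      finally show ?thesis using False by (simp add: field_simps)
    qed
  next
    assume "\<And>h. h \<noteq> 0 \<Longrightarrow> 0 < W h"
    moreover have "x \<noteq> 0" using x by auto
    ultimately show "0 < W x" by blast
  qed
qed

text \<open>The gap \<open>W h - W (A h)\<close> is again continuous, homogeneous of degree 2 and
  positive off 0, hence at least \<open>c * (norm h)\<^sup>2\<close>. Near \<open>p\<close> the
  linearization error costs at most half of it.\<close>

lemma linearized_decrease:
  fixes f A :: "'a::euclidean_space \<Rightarrow> 'a" and W :: "'a \<Rightarrow> real"
  assumes cont: "continuous_on UNIV W" and hom: "\<And>t h. W (t *\<^sub>R h) = t\<^sup>2 * W h"
    and der: "(f has_derivative A) (at p)" and fixp: "f p = p"
    and dec: "\<And>h. h \<noteq> 0 \<Longrightarrow> W (A h) < W h"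
  obtains \<delta> r where "0 < \<delta>" "0 < r"
    and "\<And>h. norm h < r \<Longrightarrow> W (f (p + h) - p) \<le> W h - \<delta> * (norm h)\<^sup>2"
proof -
  have bl: "bounded_linear A" using der by (rule has_derivative_bounded_linear)
  interpret A: bounded_linear A by fact
  have cont': "continuous_on UNIV (\<lambda>h. W h - W (A h))"
    by (intro continuous_intros cont A.continuous_on
        continuous_on_compose2[OF cont, of _ A]) auto
  have hom': "W (t *\<^sub>R h) - W (A (t *\<^sub>R h)) = t\<^sup>2 * (W h - W (A h))" for t h
    by (simp add: hom A.scale algebra_simps)
  obtain c where c: "\<And>h. c * (norm h)\<^sup>2 \<le> W h - W (A h)" and c0: "0 < c"
    using homogeneous_lower_bound[OF cont' hom'] dec by (metis diff_gt_0_iff_gt)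
  obtain K where K: "\<And>h. norm (A h) \<le> norm h * K" and K0: "0 < K"
    using A.pos_bounded by blast
  \<comment> \<open>Images of unit vectors under \<open>A\<close> have norm at most
    \<open>K\<close>, and the tolerance \<open>e\<close> is at most 1, so this ball contains both
    vectors compared.\<close>
  have "uniformly_continuous_on (cball 0 (K + 1)) W"
    by (rule compact_uniformly_continuous) (use cont continuous_on_subset in auto)
  then obtain d where d: "0 < d" and
    unif: "\<And>u v. \<lbrakk>u \<in> cball 0 (K + 1); v \<in> cball 0 (K + 1); dist v u < d\<rbrakk> \<Longrightarrow> dist (W v) (W u) < c / 2"
    unfolding uniformly_continuous_on_def using c0 by (metis half_gt_zero)
  define e where "e = min 1 (d / 2)"
  have e: "0 < e" "e \<le> 1" "e < d" using d by (auto simp: e_def)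
  obtain r where r: "0 < r" and
    approx: "\<And>y. norm (y - p) < r \<Longrightarrow> norm (f y - f p - A (y - p)) \<le> e * norm (y - p)"
    using der e(1) unfolding has_derivative_at_alt by blast
  show ?thesis
  proof (rule that[of "c / 2" r])
    fix h :: 'a assume h: "norm h < r"
    show "W (f (p + h) - p) \<le> W h - c / 2 * (norm h)\<^sup>2"
    proof (cases "h = 0")
      case True
      then show ?thesis by (simp add: fixp)
    next
      case False
      \<comment> \<open>Dividing by \<open>norm h\<close> turns the linearization error into a
        distance of at most \<open>e\<close>, to which uniform continuity of \<open>W\<close>
        applies; homogeneity later undoes the scaling.\<close>
      define u v where "u = A h /\<^sub>R norm h" and "v = (f (p + h) - p) /\<^sub>R norm h"
      have "dist v u = norm (f (p + h) - p - A h) / norm h"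
        by (simp add: u_def v_def dist_norm divide_inverse flip: scaleR_diff_right)
      also have "\<dots> \<le> e" using approx[of "p + h"] h False by (simp add: fixp field_simps)
      finally have vu: "dist v u \<le> e" .
      have u: "norm u \<le> K"
        using K[of h] False by (simp add: u_def field_simps)
      have "norm v \<le> norm u + dist v u"
        by (metis dist_norm norm_triangle_sub)
      then have "dist (W v) (W u) < c / 2"
        using u vu e by (intro unif) (auto simp: dist_commute)
      then have "W v \<le> W u + c / 2" unfolding dist_real_def by linarith
      then have "(norm h)\<^sup>2 * W v \<le> (norm h)\<^sup>2 * (W u + c / 2)"
        by (rule mult_left_mono) simp
      moreover have "(norm h)\<^sup>2 * W v = W (f (p + h) - p)" "(norm h)\<^sup>2 * W u = W (A h)"
        using False by (simp_all add: u_def v_def flip: hom)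
      ultimately show ?thesis using c[of h] by (simp add: algebra_simps)
    qed
  qed (use c0 r in auto)
qed

text \<open>Small sublevel sets of the positive definite \<open>W\<close> trap orbits, which gives
  stability; the summed decrements then force convergence.\<close>

theorem lyapunov_asymptotically_stable:
  fixes f A :: "'a::euclidean_space \<Rightarrow> 'a" and W :: "'a \<Rightarrow> real"
  assumes cont: "continuous_on UNIV W" and hom: "\<And>t h. W (t *\<^sub>R h) = t\<^sup>2 * W h"
    and der: "(f has_derivative A) (at p)" and fp: "fixed_point_on S f p"
    and dec: "\<And>h. h \<noteq> 0 \<Longrightarrow> W (A h) < W h"
    and pos: "\<And>h. h \<noteq> 0 \<Longrightarrow> 0 < W h"
  shows "asymptotically_stable_on S f p"
proof -
  have fixp: "f p = p" using fp by (simp add: fixed_point_on_def)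
  obtain \<delta> r where \<delta>: "0 < \<delta>" and r: "0 < r" and
    step: "\<And>h. norm h < r \<Longrightarrow> W (f (p + h) - p) \<le> W h - \<delta> * (norm h)\<^sup>2"
    using linearized_decrease[OF cont hom der fixp dec] by blast
  obtain c where c: "\<And>h. c * (norm h)\<^sup>2 \<le> W h" and c0: "0 < c"
    using homogeneous_lower_bound[OF cont hom] pos by metis
  have W0: "W 0 = 0" using hom[of 0 0] by simp
  have nonneg: "0 \<le> W h" for h
    using pos[of h] W0 by (cases "h = 0") auto
  define g where "g q n = (f ^^ n) q - p" for q n
  have g_Suc: "g q (Suc n) = f (p + g q n) - p" for q n by (simp add: g_def)
  \<comment> \<open>Where \<open>W h < c * \<rho>\<^sup>2\<close>, the norm is below
    \<open>\<rho> \<le> r\<close>, so the decrease applies and the orbit never leaves this sublevel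
    set.\<close>
  have near: "\<exists>d>0. \<forall>q. dist q p < d \<longrightarrow> (\<forall>n. norm (g q n) < \<rho>)" if \<rho>: "0 < \<rho>" "\<rho> \<le> r" for \<rho>
  proof -
    have "isCont W 0" using cont by (simp add: continuous_on_eq_continuous_at)
    moreover have "0 < c * \<rho>\<^sup>2" using c0 \<rho> by simp
    ultimately obtain d where d: "0 < d" and small: "\<And>h. dist h 0 < d \<Longrightarrow> dist (W h) (W 0) < c * \<rho>\<^sup>2"
      unfolding continuous_at_eps_delta by blast
    have "norm (g q n) < \<rho> \<and> W (g q n) < c * \<rho>\<^sup>2" if q: "dist q p < d" for q n
    proof -
      have norm_less: "norm h < \<rho>" if "W h < c * \<rho>\<^sup>2" for h
      proof -
        have "c * (norm h)\<^sup>2 < c * \<rho>\<^sup>2" using c[of h] that by linarith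
        then have "(norm h)\<^sup>2 < \<rho>\<^sup>2" using c0 by simp
        then show ?thesis using \<rho> by (simp add: power_less_imp_less_base)
      qed
      have "W (g q n) < c * \<rho>\<^sup>2"
      proof (induction n)
        case 0
        show ?case using small[of "q - p"] q W0 by (simp add: g_def dist_norm)
      next
        case (Suc n)
        have "W (g q (Suc n)) \<le> W (g q n) - \<delta> * (norm (g q n))\<^sup>2"
          unfolding g_Suc using norm_less[OF Suc] \<rho> by (intro step) simp
        moreover have "0 \<le> \<delta> * (norm (g q n))\<^sup>2" using \<delta> by simp
        ultimately show ?case using Suc by linarith
      qed
      then show ?thesis using norm_less by blast
    qed
    then show ?thesis using d by blast
  qed
  have "lyapunov_stable_on S f p"
    unfolding lyapunov_stable_on_def
  proof (intro allI impI)
    fix \<epsilon> :: real assume "0 < \<epsilon>"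
    then obtain d where "0 < d" "\<forall>q. dist q p < d \<longrightarrow> (\<forall>n. norm (g q n) < min \<epsilon> r)"
      using near[of "min \<epsilon> r"] r by auto
    then show "\<exists>\<delta>>0. \<forall>q\<in>S. dist q p < \<delta> \<longrightarrow> (\<forall>n. dist ((f ^^ n) q) p < \<epsilon>)"
      by (auto simp: g_def dist_norm)
  qed
  moreover obtain d where d: "0 < d" and stay: "\<And>q n. dist q p < d \<Longrightarrow> norm (g q n) < r"
    using near[of r] r by auto
  have "(\<lambda>n. (f ^^ n) q) \<longlonglongrightarrow> p" if q: "dist q p < d" for q
  proof -
    \<comment> \<open>Telescoping bounds the total decrement by the initial value of
      \<open>W\<close>, so the squared norms are summable.\<close>
    have part: "W (g q n) + (\<Sum>i<n. \<delta> * (norm (g q i))\<^sup>2) \<le> W (g q 0)" for n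
    proof (induction n)
      case (Suc n)
      then show ?case using step[OF stay[OF q, of n]] by (simp add: g_Suc)
    qed simp
    have "summable (\<lambda>n. \<delta> * (norm (g q n))\<^sup>2)"
    proof (rule summableI_nonneg_bounded)
      show "(\<Sum>i<n. \<delta> * (norm (g q i))\<^sup>2) \<le> W (g q 0)" for n
        using part[of n] nonneg[of "g q n"] by linarith
    qed (use \<delta> in simp)
    then have "(\<lambda>n. \<delta> * (norm (g q n))\<^sup>2) \<longlonglongrightarrow> 0" by (rule summable_LIMSEQ_zero)
    then have "(\<lambda>n. sqrt (\<delta> * (norm (g q n))\<^sup>2 / \<delta>)) \<longlonglongrightarrow> sqrt (0 / \<delta>)"
      by (intro tendsto_intros) (use \<delta> in auto)
    then have "(\<lambda>n. norm (g q n)) \<longlonglongrightarrow> 0" using \<delta> by simp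
    then show ?thesis
      unfolding g_def by (simp add: tendsto_norm_zero_iff LIM_zero_iff)
  qed
  with d have "\<exists>\<delta>>0. \<forall>q\<in>S. dist q p < \<delta> \<longrightarrow> (\<lambda>n. (f ^^ n) q) \<longlonglongrightarrow> p" by blast
  ultimately show ?thesis using fp by (simp add: asymptotically_stable_on_def)
qed

text \<open>An orbit starting close to \<open>p\<close> in direction \<open>v\<close> has negative
  \<open>W\<close>. Were it confined to the ball of radius \<open>r\<close>, \<open>W\<close> would
  fall by a fixed amount at every step, against its lower bound there.\<close>

theorem lyapunov_unstable:
  fixes f A :: "'a::euclidean_space \<Rightarrow> 'a" and W :: "'a \<Rightarrow> real"
  assumes cont: "continuous_on UNIV W" and hom: "\<And>t h. W (t *\<^sub>R h) = t\<^sup>2 * W h"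
    and der: "(f has_derivative A) (at p)" and fp: "fixed_point_on S f p"
    and dec: "\<And>h. h \<noteq> 0 \<Longrightarrow> W (A h) < W h"
    and neg: "W v < 0" and int: "p \<in> interior S"
  shows "unstable_on S f p"
proof -
  have fixp: "f p = p" using fp by (simp add: fixed_point_on_def)
  obtain \<delta> r where \<delta>: "0 < \<delta>" and r: "0 < r" and
    step: "\<And>h. norm h < r \<Longrightarrow> W (f (p + h) - p) \<le> W h - \<delta> * (norm h)\<^sup>2"
    using linearized_decrease[OF cont hom der fixp dec] by blast
  obtain c where c: "\<And>h. c * (norm h)\<^sup>2 \<le> W h"
    using homogeneous_lower_bound[OF cont hom] by metis
  have v0: "v \<noteq> 0" using neg hom[of 0 0] by auto
  have "\<not> lyapunov_stable_on S f p"
  proof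
    assume "lyapunov_stable_on S f p"
    then obtain d where d: "0 < d"
      and stay: "\<And>q n. \<lbrakk>q \<in> S; dist q p < d\<rbrakk> \<Longrightarrow> dist ((f ^^ n) q) p < r"
      unfolding lyapunov_stable_on_def using r by meson
    obtain e where e: "0 < e" "ball p e \<subseteq> S" using int mem_interior by blast
    define t where "t = min d e / 2 / norm v"
    have t: "0 < t" using d e v0 by (simp add: t_def)
    define q where "q = p + t *\<^sub>R v"
    have "dist q p = min d e / 2" using v0 d e by (simp add: q_def dist_norm t_def)
    then have q: "q \<in> S" "dist q p < d" using d e by (auto simp: dist_commute)
    define g where "g n = (f ^^ n) q - p" for n
    have g_Suc: "g (Suc n) = f (p + g n) - p" for n by (simp add: g_def)
    have small: "norm (g n) < r" for n using stay[OF q, of n] by (simp add: g_def dist_norm)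
    have W0: "W (g 0) < 0" using neg t by (simp add: g_def q_def hom mult_pos_neg)
    have "c * (norm (g 0))\<^sup>2 < 0" using c[of "g 0"] W0 by linarith
    then have c0: "c < 0" by (simp add: mult_less_0_iff)
    \<comment> \<open>Since \<open>c * (norm (g n))\<^sup>2 \<le> W (g n) \<le> W (g 0)\<close> with
      \<open>c < 0\<close>, the squared distance from \<open>p\<close> is at least
      \<open>W (g 0) / c\<close>; hence each step loses at least \<open>\<kappa>\<close>.\<close>
    define \<kappa> where "\<kappa> = \<delta> * (W (g 0) / c)"
    have \<kappa>: "0 < \<kappa>" unfolding \<kappa>_def using \<delta> W0 c0 by (intro mult_pos_pos divide_neg_neg)
    have W_le: "W (g n) \<le> W (g 0) - real n * \<kappa>" for n
    proof (induction n)
      case (Suc n)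
      have "0 \<le> real n * \<kappa>" using \<kappa> by simp
      then have "c * (norm (g n))\<^sup>2 \<le> W (g 0)" using c[of "g n"] Suc by linarith
      then have "W (g 0) / c \<le> (norm (g n))\<^sup>2" using c0 by (simp add: neg_divide_le_eq mult.commute)
      then have "\<kappa> \<le> \<delta> * (norm (g n))\<^sup>2" 
        unfolding \<kappa>_def using \<delta> by (intro mult_left_mono) auto
      then show ?case using step[OF small, of n] Suc by (simp add: g_Suc algebra_simps)
    qed simp
    obtain n where n: "- c * r\<^sup>2 < real n * \<kappa>" using reals_Archimedean3[OF \<kappa>] by blast
    have "(norm (g n))\<^sup>2 \<le> r\<^sup>2" using small[of n] by (intro power_mono) auto
    then have "c * r\<^sup>2 \<le> c * (norm (g n))\<^sup>2" using c0 by simp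
    then show False using c[of "g n"] W_le[of n] n W0 by linarith
  qed
  then show ?thesis using fp by (simp add: unstable_on_def)
qed

section \<open>A quadratic form for planar matrices\<close>

text \<open>
  By Cayley--Hamilton a coordinate of an orbit of a planar matrix with trace \<open>T\<close> and determinant
  \<open>D\<close> satisfies \<open>y'' = T * y' - D * y\<close>. The coefficients below are chosen to make the decrement of
  the form along this recursion a multiple of \<open>y\<^sup>2 + y'\<^sup>2\<close>.
\<close>

definition schur_gap :: "real \<Rightarrow> real \<Rightarrow> real" where
  "schur_gap T D = (1 - D) * ((1 + D)\<^sup>2 - T\<^sup>2) / 2"

definition schur_form :: "real \<Rightarrow> real \<Rightarrow> real \<Rightarrow> real \<Rightarrow> real" where
  "schur_form T D y z =
     ((1 + D) * D\<^sup>2 + schur_gap T D) * y\<^sup>2 - 2 * T * D * y * z + (1 + D) * z\<^sup>2"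

text \<open>\<open>y\<close>, \<open>z\<close> and \<open>T * z - D * y\<close> are consecutive
  values of the recursion. The gap is half the product of the Jury quantities \<open>1 - D\<close>,
  \<open>1 + D - T\<close> and \<open>1 + D + T\<close>.\<close>

lemma schur_form_decrement:
  "schur_form T D y z - schur_form T D z (T * z - D * y) = schur_gap T D * (y\<^sup>2 + z\<^sup>2)"
  unfolding schur_form_def schur_gap_def by (simp add: field_simps) algebra

lemma schur_form_scale: "schur_form T D (t * y) (t * z) = t\<^sup>2 * schur_form T D y z"
  unfolding schur_form_def by algebra

lemma schur_gap_factor_pos: "0 < (1 + D)\<^sup>2 - T\<^sup>2" if "\<bar>T\<bar> < 1 + D" for T D :: real
  using power_strict_mono[OF that, of 2] by simp

text \<open>Multiplying by \<open>1 + D\<close> and completing the square in \<open>z\<close> leaves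
  a positive multiple of \<open>y\<^sup>2\<close>; for \<open>y = 0\<close> the square itself is
  positive.\<close>

lemma schur_form_pos:
  assumes T: "\<bar>T\<bar> < 1 + D" and D: "D < 1" and yz: "y \<noteq> 0 \<or> z \<noteq> 0"
  shows "0 < schur_form T D y z"
proof -
  have D1: "0 < 1 + D" using T by linarith
  have gap: "0 < schur_gap T D"
    using schur_gap_factor_pos[OF T] D by (simp add: schur_gap_def)
  have "(1 + D) * schur_form T D y z =
      ((1 + D) * z - T * D * y)\<^sup>2 + (D\<^sup>2 * ((1 + D)\<^sup>2 - T\<^sup>2) + (1 + D) * schur_gap T D) * y\<^sup>2"
    unfolding schur_form_def by algebra
  moreover have "0 < D\<^sup>2 * ((1 + D)\<^sup>2 - T\<^sup>2) + (1 + D) * schur_gap T D"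
    by (rule add_nonneg_pos) (use schur_gap_factor_pos[OF T] D1 gap in auto)
  moreover have "0 < ((1 + D) * z - T * D * y)\<^sup>2 + K * y\<^sup>2" if "0 < K" for K
  proof (cases "y = 0")
    case True
    then show ?thesis using yz D1 by simp
  next
    case False
    then show ?thesis using that by (intro add_nonneg_pos) auto
  qed
  ultimately have "0 < (1 + D) * schur_form T D y z" by presburger
  then show ?thesis using D1 by (simp add: zero_less_mult_iff)
qed

text \<open>
  The hypothesis \<open>c \<noteq> 0\<close> makes the second coordinates of a vector and of its image determine the
  vector. The sign \<open>\<sigma>\<close> of the planar part is chosen so that the form always decreases.
\<close>

lemma block_lyapunov_form:
  fixes a b c d s :: real
  defines "T \<equiv> a + d" and "D \<equiv> a * d - b * c"
  defines "A \<equiv> \<lambda>(w, l, x). (a * w + b * l, c * w + d * l, s * x)"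
  defines "\<sigma> \<equiv> if D < 1 then 1 else - 1"
  defines "W \<equiv> \<lambda>(w, l, x). \<sigma> * schur_form T D l (c * w + d * l) + x\<^sup>2"
  assumes c: "c \<noteq> 0" and s: "\<bar>s\<bar> < 1" and T: "\<bar>T\<bar> < 1 + D" and D: "D \<noteq> 1"
  shows "continuous_on UNIV W"
    and "W (t *\<^sub>R h) = t\<^sup>2 * W h"
    and "h \<noteq> 0 \<Longrightarrow> W (A h) < W h"
    and "D < 1 \<Longrightarrow> h \<noteq> 0 \<Longrightarrow> 0 < W h"
    and "1 < D \<Longrightarrow> W (1, 0, 0) < 0"
proof -
  show "continuous_on UNIV W"
    unfolding W_def schur_form_def case_prod_beta by (intro continuous_intros)
  obtain w l x where h: "h = (w, l, x)" by (cases h)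
  have "schur_form T D (t * l) (c * (t * w) + d * (t * l)) = t\<^sup>2 * schur_form T D l (c * w + d * l)"
    using schur_form_scale[of T D t l "c * w + d * l"] by (simp add: algebra_simps)
  then show "W (t *\<^sub>R h) = t\<^sup>2 * W h" by (simp add: W_def h algebra_simps)
  define y where "y = c * w + d * l"
  have nz: "l \<noteq> 0 \<or> y \<noteq> 0 \<or> x \<noteq> 0" if "h \<noteq> 0"
    using that c by (auto simp: h y_def zero_prod_def)
  \<comment> \<open>Cayley-Hamilton: \<open>y\<close> is the \<open>l\<close>-coordinate of the
    image, so \<open>A\<close> sends the pair \<open>(l, y)\<close> to
    \<open>(y, T * y - D * l)\<close>.\<close>
  have "c * (a * w + b * l) + d * y = T * y - D * l"
    unfolding T_def D_def y_def by algebra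
  then have WA: "W (A h) = \<sigma> * schur_form T D y (T * y - D * l) + (s * x)\<^sup>2"
    by (simp add: W_def A_def h y_def)
  have Wh: "W h = \<sigma> * schur_form T D l y + x\<^sup>2" by (simp add: W_def h y_def)
  show "W (A h) < W h" if "h \<noteq> 0"
  proof -
    \<comment> \<open>\<open>\<sigma>\<close> has the sign of \<open>1 - D\<close>, the only factor
      of the gap whose sign varies.\<close>
    have gap: "0 < \<sigma> * schur_gap T D"
      using schur_gap_factor_pos[OF T] D
      by (auto simp: \<sigma>_def schur_gap_def mult_neg_pos)
    have "s\<^sup>2 < 1" using s by (simp add: abs_square_less_1)
    have "W h - W (A h) = \<sigma> * schur_gap T D * (l\<^sup>2 + y\<^sup>2) + (1 - s\<^sup>2) * x\<^sup>2"
      using schur_form_decrement[of T D l y] unfolding WA Wh by algebra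
    also have "\<dots> > 0"
    proof (cases "x = 0")
      case True
      then have "0 < l\<^sup>2 + y\<^sup>2" using nz[OF that] by (simp add: sum_power2_gt_zero_iff)
      then show ?thesis using gap True by simp
    next
      case False
      then show ?thesis using gap \<open>s\<^sup>2 < 1\<close> by (intro add_nonneg_pos) auto
    qed
    finally show ?thesis by simp
  qed
  show "0 < W h" if "D < 1" "h \<noteq> 0"
  proof (cases "l = 0 \<and> y = 0")
    case True
    then show ?thesis using nz[OF that(2)] by (simp add: Wh schur_form_def)
  next
    case False
    then have "0 < schur_form T D l y" using T that by (intro schur_form_pos) auto
    then show ?thesis using that by (simp add: Wh \<sigma>_def add_pos_nonneg)
  qed
  \<comment> \<open>At this vector \<open>l = 0\<close> and \<open>y = c\<close>, so
    \<open>W\<close> equals \<open>- (1 + D) * c\<^sup>2\<close>.\<close>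
  show "W (1, 0, 0) < 0" if "1 < D"
    using that c by (simp add: W_def \<sigma>_def schur_form_def)
qed

section \<open>The Adam system\<close>

locale adam_params =
  fixes k m :: nat and \<eta> \<beta>\<^sub>1 \<beta>\<^sub>2 s :: real
  assumes k: "k = m + 2" and m: "2 \<le> m" and \<eta>: "0 < \<eta>"
    and \<beta>1: "0 \<le> \<beta>\<^sub>1" "\<beta>\<^sub>1 < 1" and \<beta>2: "0 < \<beta>\<^sub>2" "\<beta>\<^sub>2 < 1"
    and s_def: "s = \<beta>\<^sub>2 powr (1 / (2 * (real k - 2)))"
begin

section \<open>Powers of \<open>\<beta>\<^sub>2\<close> as powers of \<open>s\<close>\<close>

lemma s_pos: "0 < s"
  using \<beta>2 by (simp add: s_def)

lemma s_less_1: "s < 1"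
proof -
  have "s < 1 powr (1 / (2 * (real k - 2)))"
    unfolding s_def using \<beta>2 k m by (intro powr_less_mono2) auto
  then show ?thesis by simp
qed

lemma powr_eq_s_power: "\<beta>\<^sub>2 powr (real n / (2 * (real k - 2))) = s ^ n"
  using s_pos by (simp add: s_def powr_powr flip: powr_realpow)

text \<open>At \<open>x = 0\<close> and \<open>l > 0\<close> the recursion for \<open>l\<close>
  fixes its value exactly when the \<open>m\<close>-th power of the factor is
  \<open>sqrt \<beta>\<^sub>2\<close>; \<open>s\<close> is the positive root.\<close>

lemma s_power_m: "s ^ m = sqrt \<beta>\<^sub>2"
proof -
  have "s ^ m = \<beta>\<^sub>2 powr (real m / (2 * (real k - 2)))" by (rule powr_eq_s_power[symmetric])
  also have "real m / (2 * (real k - 2)) = 1 / 2" using k m by simp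
  finally show ?thesis using \<beta>2 by (simp add: powr_half_sqrt)
qed

lemma powr_minus_eq: "\<beta>\<^sub>2 powr (- ((real k - 1) / (2 * (real k - 2)))) = 1 / s ^ (m + 1)"
  using powr_eq_s_power[of "m + 1"] by (simp add: powr_minus_divide k add.commute)

lemma nontrivial_omega_eq: "nontrivial_omega k \<beta>\<^sub>1 \<beta>\<^sub>2 = (1 - \<beta>\<^sub>1) / (1 - \<beta>\<^sub>1 / s ^ (m + 1))"
  unfolding nontrivial_omega_def powr_minus_eq by simp

lemma nontrivial_lambda_eq:
  "nontrivial_lambda k \<eta> \<beta>\<^sub>1 \<beta>\<^sub>2 = (1 - s) / (\<eta> * nontrivial_omega k \<beta>\<^sub>1 \<beta>\<^sub>2)"
  by (simp add: nontrivial_lambda_def s_def)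

section \<open>Fixed points for \<open>\<beta>\<^sub>1\<close> above the existence threshold\<close>

lemma not_nontrivial_exists:
  assumes "s ^ (m + 1) < \<beta>\<^sub>1"
  shows "\<not> nontrivial_exists k \<eta> \<beta>\<^sub>1 \<beta>\<^sub>2"
proof -
  have "1 - \<beta>\<^sub>1 / s ^ (m + 1) < 0" using assms s_pos by simp
  then have "nontrivial_omega k \<beta>\<^sub>1 \<beta>\<^sub>2 < 0"
    unfolding nontrivial_omega_eq using \<beta>1 by (intro divide_pos_neg) auto
  then have "nontrivial_lambda k \<eta> \<beta>\<^sub>1 \<beta>\<^sub>2 < 0"
    unfolding nontrivial_lambda_eq using \<eta> s_less_1 by (intro divide_pos_neg mult_pos_neg) auto
  then show ?thesis by (simp add: nontrivial_exists_def)
qed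

text \<open>The equation for \<open>x\<close> leaves two cases. A factor equal to 1 forces
  \<open>\<omega> = 1\<close> and then \<open>l = 0\<close>; otherwise \<open>x = 0\<close>, and the
  only positive factor the equation for \<open>l\<close> admits is \<open>s\<close>, which would
  make \<open>\<omega>\<close> negative.\<close>

lemma trivial_fixed_points:
  assumes "s ^ (m + 1) < \<beta>\<^sub>1"
  shows "fixed_point_on adam_states (adam_step k \<eta> \<beta>\<^sub>1 \<beta>\<^sub>2) (\<omega>, l, x) \<and> 0 < 1 - \<eta> * \<omega> * l \<longleftrightarrow>
    \<omega> = 1 \<and> l = 0"
proof
  assume "fixed_point_on adam_states (adam_step k \<eta> \<beta>\<^sub>1 \<beta>\<^sub>2) (\<omega>, l, x) \<and> 0 < 1 - \<eta> * \<omega> * l"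
  moreover define r where "r = 1 - \<eta> * \<omega> * l"
  ultimately have r: "0 < r" and l: "0 \<le> l" and \<omega>_eq: "\<beta>\<^sub>1 * \<omega> / r ^ (m + 1) + 1 - \<beta>\<^sub>1 = \<omega>"
    and l_eq: "r ^ m * l / sqrt (\<beta>\<^sub>2 + (1 - \<beta>\<^sub>2) * r ^ (2 * m + 2) * l\<^sup>2 * x\<^sup>2) = l"
    and x_eq: "r * x = x"
    by (auto simp: fixed_point_on_def adam_states_def adam_step_def k)
  show "\<omega> = 1 \<and> l = 0"
  proof (cases "r = 1")
    case True
    have "(1 - \<beta>\<^sub>1) * \<omega> = 1 - \<beta>\<^sub>1" using \<omega>_eq True by (simp add: algebra_simps)
    then have "\<omega> = 1" using \<beta>1 by simp
    then show ?thesis using True \<eta> by (simp add: r_def)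
  next
    case False
    then have "x = 0" "l \<noteq> 0" using x_eq by (auto simp: r_def)
    then have "r ^ m = s ^ m" using l_eq \<beta>2 by (simp add: s_power_m field_simps)
    then have "r = s" using r s_pos m by (metis less_imp_le power_eq_iff_eq_base not_numeral_le_zero not_gr0)
    then have "\<omega> * (1 - \<beta>\<^sub>1 / s ^ (m + 1)) = 1 - \<beta>\<^sub>1" using \<omega>_eq by (simp add: algebra_simps)
    moreover have "1 - \<beta>\<^sub>1 / s ^ (m + 1) < 0" using assms s_pos by simp
    ultimately have "\<omega> < 0" using \<beta>1 by (metis diff_gt_0_iff_gt zero_less_mult_iff not_less_iff_gr_or_eq)
    \<comment> \<open>A negative \<open>\<omega>\<close> gives a factor of at least 1, contradicting
      \<open>s < 1\<close>.\<close>
    then have "\<eta> * \<omega> * l \<le> 0" using \<eta> l by (simp add: mult_nonneg_nonpos2 mult_nonneg_nonpos)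
    then show ?thesis using \<open>r = s\<close> s_less_1 by (simp add: r_def)
  qed
qed (auto simp: fixed_point_on_def adam_states_def adam_step_def)

end

section \<open>The non-trivial fixed point below the existence threshold\<close>

locale adam_nontrivial = adam_params +
  fixes \<omega> l D :: real
  assumes \<beta>1_less: "\<beta>\<^sub>1 < s ^ (m + 1)"
    and \<omega>_def: "\<omega> = nontrivial_omega k \<beta>\<^sub>1 \<beta>\<^sub>2" and l_def: "l = nontrivial_lambda k \<eta> \<beta>\<^sub>1 \<beta>\<^sub>2"
    and D_def: "D = \<beta>\<^sub>1 / s ^ (m + 2)"
begin

lemma denominator_pos: "0 < 1 - \<beta>\<^sub>1 / s ^ (m + 1)"
  using \<beta>1_less s_pos by simp

lemma omega_pos: "0 < \<omega>"
  unfolding \<omega>_def nontrivial_omega_eq using \<beta>1 denominator_pos by (intro divide_pos_pos) auto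

lemma lambda_pos: "0 < l"
  unfolding l_def nontrivial_lambda_eq using omega_pos \<eta> s_less_1
  by (intro divide_pos_pos mult_pos_pos) (auto simp: \<omega>_def)

lemma nontrivial_exists: "nontrivial_exists k \<eta> \<beta>\<^sub>1 \<beta>\<^sub>2"
  using denominator_pos omega_pos lambda_pos \<eta>
  unfolding nontrivial_exists_def powr_minus_eq \<omega>_def l_def times_divide_eq_right mult_1_right
  by (intro conjI less_imp_le less_imp_neq[THEN not_sym] mult_pos_pos)

lemma factor_eq: "1 - \<eta> * \<omega> * l = s"
proof -
  have "\<eta> * \<omega> \<noteq> 0" using omega_pos \<eta> by simp
  then show ?thesis by (simp add: l_def nontrivial_lambda_eq \<omega>_def)
qed

lemma omega_eq: "\<beta>\<^sub>1 * \<omega> / s ^ (m + 1) + 1 - \<beta>\<^sub>1 = \<omega>"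
proof -
  have "\<omega> * (1 - \<beta>\<^sub>1 / s ^ (m + 1)) = 1 - \<beta>\<^sub>1"
    unfolding \<omega>_def nontrivial_omega_eq using denominator_pos by (metis less_irrefl nonzero_eq_divide_eq)
  then show ?thesis by (simp add: algebra_simps)
qed

lemma fixed_point: "fixed_point_on adam_states (adam_step k \<eta> \<beta>\<^sub>1 \<beta>\<^sub>2) (\<omega>, l, 0)"
  using omega_eq lambda_pos \<beta>2
  by (simp add: fixed_point_on_def adam_states_def adam_step_def factor_eq k s_power_m)

text \<open>Strict positivity of \<open>l\<close> makes small perturbations in every direction
  admissible, as the instability criterion requires.\<close>

lemma interior_states: "(\<omega>, l, 0) \<in> interior adam_states"
proof (rule interiorI)
  show "open {q :: real \<times> real \<times> real. 0 < fst (snd q)}"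
    by (intro open_Collect_less continuous_intros)
qed (use lambda_pos in \<open>auto simp: adam_states_def\<close>)

section \<open>Jacobian at the non-trivial fixed point and its spectrum\<close>

definition jac_a where "jac_a = D * (s + (real m + 1) * (1 - s))"
definition jac_b where "jac_b = D * (real m + 1) * \<eta> * \<omega>\<^sup>2"
definition jac_c where "jac_c = - (real m * \<eta> * l\<^sup>2 / s)"
definition jac_d where "jac_d = 1 - real m * (1 - s) / s"

text \<open>\<open>x\<close> enters the first two components only through \<open>x\<^sup>2\<close>,
  so at \<open>x = 0\<close> it decouples to first order and contributes the diagonal entry
  \<open>s\<close>.\<close>

lemma adam_step_has_derivative:
  "(adam_step k \<eta> \<beta>\<^sub>1 \<beta>\<^sub>2 has_derivative
     (\<lambda>(w, v, x). (jac_a * w + jac_b * v, jac_c * w + jac_d * v, s * x))) (at (\<omega>, l, 0))"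
proof -
  let ?p = "(\<omega>, l, 0::real)"
  define u :: "real \<times> real \<times> real \<Rightarrow> real" where "u q = 1 - \<eta> * fst q * fst (snd q)" for q
  define u' :: "real \<times> real \<times> real \<Rightarrow> real" where
    "u' h = - (\<eta> * (\<omega> * fst (snd h) + fst h * l))" for h
  have u: "(u has_derivative u') (at ?p)"
    unfolding u_def u'_def by (auto intro!: derivative_eq_intros simp: algebra_simps)
  have up: "u ?p = s" by (simp add: u_def factor_eq)
  have s0: "s \<noteq> 0" using s_pos by simp
  then have nz: "u ?p ^ (m + 1) \<noteq> 0" by (simp add: up)
  have \<eta>\<omega>l: "\<eta> * \<omega> * l = 1 - s" using factor_eq by simp
  have d1: "((\<lambda>q. \<beta>\<^sub>1 * fst q / u q ^ (m + 1) + 1 - \<beta>\<^sub>1) has_derivative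
      (\<lambda>h. jac_a * fst h + jac_b * fst (snd h))) (at ?p)"
  proof (rule has_derivative_eq_rhs)
    show "((\<lambda>q. \<beta>\<^sub>1 * fst q / u q ^ (m + 1) + 1 - \<beta>\<^sub>1) has_derivative
        (\<lambda>h. \<beta>\<^sub>1 * (fst h * s ^ (m + 1) - \<omega> * (real (m + 1) * s ^ m * u' h)) / (s ^ (m + 1))\<^sup>2)) (at ?p)"
      by (rule derivative_eq_intros u nz refl)+ (simp add: up power2_eq_square algebra_simps)
    \<comment> \<open>Restoring \<open>\<eta> * \<omega> * l\<close> in place of
      \<open>1 - s\<close> makes both sides rational expressions in the same variables.\<close>
    have jac: "jac_a = D * (s + (real m + 1) * (\<eta> * \<omega> * l))" by (simp add: jac_a_def \<eta>\<omega>l)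
    show "(\<lambda>h. \<beta>\<^sub>1 * (fst h * s ^ (m + 1) - \<omega> * (real (m + 1) * s ^ m * u' h)) / (s ^ (m + 1))\<^sup>2) =
        (\<lambda>h. jac_a * fst h + jac_b * fst (snd h))"
      unfolding jac jac_b_def unfolding D_def u'_def
      using s0 by (auto simp: field_simps power2_eq_square)
  qed
  let ?R = "\<lambda>q. \<beta>\<^sub>2 + (1 - \<beta>\<^sub>2) * u q ^ (2 * m + 2) * (fst (snd q))\<^sup>2 * (snd (snd q))\<^sup>2"
  \<comment> \<open>The derivative vanishes because of the factor \<open>x\<^sup>2\<close>.\<close>
  have R: "(?R has_derivative (\<lambda>h. 0)) (at ?p)"
    by (rule derivative_eq_intros u refl)+ simp
  have R_pos: "0 < ?R ?p" and R_nz: "sqrt (?R ?p) \<noteq> 0" using \<beta>2 by auto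
  have d2: "((\<lambda>q. u q ^ m * fst (snd q) / sqrt (?R q)) has_derivative
      (\<lambda>h. jac_c * fst h + jac_d * fst (snd h))) (at ?p)"
  proof (rule has_derivative_eq_rhs)
    show "((\<lambda>q. u q ^ m * fst (snd q) / sqrt (?R q)) has_derivative
        (\<lambda>h. (s ^ m * fst (snd h) + real m * s ^ (m - 1) * u' h * l) / s ^ m)) (at ?p)"
      by (rule derivative_eq_intros u R R_pos R_nz has_derivative_real_sqrt refl)+
        (use \<beta>2 in \<open>simp add: up s_power_m power2_eq_square algebra_simps\<close>)
    have jac: "jac_d = 1 - real m * (\<eta> * \<omega> * l) / s" by (simp add: jac_d_def \<eta>\<omega>l)
    have "s ^ m = s * s ^ (m - 1)" using m by (simp flip: power_Suc)
    then show "(\<lambda>h. (s ^ m * fst (snd h) + real m * s ^ (m - 1) * u' h * l) / s ^ m) =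
        (\<lambda>h. jac_c * fst h + jac_d * fst (snd h))"
      using s0 by (auto simp: jac jac_c_def u'_def field_simps power2_eq_square)
  qed
  have d3: "((\<lambda>q. u q * snd (snd q)) has_derivative (\<lambda>h. s * snd (snd h))) (at ?p)"
    by (rule derivative_eq_intros u refl)+ (simp add: up)
  have "adam_step k \<eta> \<beta>\<^sub>1 \<beta>\<^sub>2 = (\<lambda>q. (\<beta>\<^sub>1 * fst q / u q ^ (m + 1) + 1 - \<beta>\<^sub>1,
      u q ^ m * fst (snd q) / sqrt (\<beta>\<^sub>2 + (1 - \<beta>\<^sub>2) * u q ^ (2 * m + 2) * (fst (snd q))\<^sup>2 * (snd (snd q))\<^sup>2),
      u q * snd (snd q)))"
    by (auto simp: adam_step_def k u_def)
  then show ?thesis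
    using has_derivative_Pair[OF d1 has_derivative_Pair[OF d2 d3]] by (simp add: case_prod_beta')
qed

text \<open>The product of the off-diagonal entries cancels the terms quadratic in
  \<open>1 - s\<close>.\<close>

lemma jac_det: "jac_a * jac_d - jac_b * jac_c = D"
proof -
  have "jac_b * jac_c = - (D * (real m + 1) * real m * (\<eta> * \<omega> * l)\<^sup>2 / s)"
    by (simp add: jac_b_def jac_c_def power2_eq_square)
  also have "\<eta> * \<omega> * l = 1 - s" using factor_eq by simp
  finally have "jac_b * jac_c = - (D * (real m + 1) * real m * (1 - s)\<^sup>2 / s)" .
  then show ?thesis
    using s_pos by (simp add: jac_a_def jac_d_def field_simps power2_eq_square)
qed

text \<open>This is the characteristic polynomial at 1, factored so that its sign is that of
  \<open>1 / s - D\<close>, that is, of \<open>s ^ (m + 1) - \<beta>\<^sub>1\<close>.\<close>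

lemma jac_trace_minus: "1 + D - (jac_a + jac_d) = real m * (1 - s) * (1 / s - D)"
  using s_pos by (simp add: jac_a_def jac_d_def field_simps)

text \<open>The characteristic polynomial at -1, grouped so that the first summand is nonnegative by
  \<open>s < 1\<close> and the second is positive exactly when
  \<open>s > m / (m + 2)\<close>.\<close>

lemma jac_trace_plus:
  "1 + D + (jac_a + jac_d) = D * (real m + 2 - real m * s) + (real m + 2 - real m / s)"
  using s_pos by (simp add: jac_a_def jac_d_def field_simps)

lemma D_nonneg: "0 \<le> D"
  using \<beta>1 s_pos by (simp add: D_def)

lemma jac_trace_bound:
  assumes "real m / (real m + 2) < s"
  shows "\<bar>jac_a + jac_d\<bar> < 1 + D"
proof -
  have "D < 1 / s" using \<beta>1_less s_pos by (simp add: D_def field_simps)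
  then have "0 < 1 + D - (jac_a + jac_d)"
    unfolding jac_trace_minus using m s_less_1 by (intro mult_pos_pos) auto
  moreover have "real m * s \<le> real m" using s_less_1 by (simp add: mult_left_le)
  then have "0 \<le> D * (real m + 2 - real m * s)" using D_nonneg by simp
  moreover have "0 < real m + 2 - real m / s" using assms s_pos by (simp add: field_simps)
  ultimately show ?thesis using jac_trace_plus by linarith
qed

lemma jac_c_nonzero: "jac_c \<noteq> 0"
  using m \<eta> lambda_pos s_pos by (simp add: jac_c_def)

lemma stability:
  assumes "real m / (real m + 2) < s"
  shows "\<beta>\<^sub>1 < s ^ (m + 2) \<Longrightarrow>
      asymptotically_stable_on adam_states (adam_step k \<eta> \<beta>\<^sub>1 \<beta>\<^sub>2) (\<omega>, l, 0)"
    and "s ^ (m + 2) < \<beta>\<^sub>1 \<Longrightarrow> unstable_on adam_states (adam_step k \<eta> \<beta>\<^sub>1 \<beta>\<^sub>2) (\<omega>, l, 0)"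
proof -
  have s1: "\<bar>s\<bar> < 1" using s_pos s_less_1 by simp
  \<comment> \<open>Unfolding the determinant to \<open>D\<close> leaves only the comparison of
    \<open>D\<close> with 1, equivalently of \<open>\<beta>\<^sub>1\<close> with
    \<open>s ^ (m + 2)\<close>.\<close>
  note form = block_lyapunov_form[of jac_c s jac_a jac_d jac_b, unfolded jac_det,
      OF jac_c_nonzero s1 jac_trace_bound[OF assms]]
  show "asymptotically_stable_on adam_states (adam_step k \<eta> \<beta>\<^sub>1 \<beta>\<^sub>2) (\<omega>, l, 0)"
    if "\<beta>\<^sub>1 < s ^ (m + 2)"
  proof -
    have D: "D < 1" using that s_pos by (simp add: D_def)
    then have "D \<noteq> 1" by simp
    from form(1,2,3,4)[OF this] show ?thesis
      by (intro lyapunov_asymptotically_stable[OF _ _ adam_step_has_derivative fixed_point]) (use D in auto)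
  qed
  show "unstable_on adam_states (adam_step k \<eta> \<beta>\<^sub>1 \<beta>\<^sub>2) (\<omega>, l, 0)" if "s ^ (m + 2) < \<beta>\<^sub>1"
  proof -
    have D: "1 < D" using that s_pos by (simp add: D_def)
    then have D1: "D \<noteq> 1" by simp
    show ?thesis
      by (rule lyapunov_unstable[OF form(1,2)[OF D1] adam_step_has_derivative fixed_point
            form(3)[OF D1] form(5)[OF D1 D] interior_states])
  qed
qed

end

section \<open>The three parameter regimes in terms of \<open>s\<close>\<close>

theorem theorem6p1:
  fixes k :: nat and \<eta> \<beta>\<^sub>1 \<beta>\<^sub>2 :: real
  assumes "even k" and "4 \<le> k" and "0 < \<eta>"
    and "0 \<le> \<beta>\<^sub>1" and "\<beta>\<^sub>1 < 1" and "0 < \<beta>\<^sub>2" and "\<beta>\<^sub>2 < 1"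
    and "\<beta>\<^sub>2 > ((real k - 2) / real k) ^ (2 * (k - 2))"
  shows
    "(\<beta>\<^sub>1 > \<beta>\<^sub>2 powr ((real k - 1) / (2 * (real k - 2))) \<longrightarrow>
        \<not> nontrivial_exists k \<eta> \<beta>\<^sub>1 \<beta>\<^sub>2 \<and>
        {(\<omega>, l, x). fixed_point_on adam_states (adam_step k \<eta> \<beta>\<^sub>1 \<beta>\<^sub>2) (\<omega>, l, x) \<and>
                    0 < 1 - \<eta> * \<omega> * l}
          = {(1, 0, c) | c. True}) \<and>
     (\<beta>\<^sub>2 powr (real k / (2 * (real k - 2))) < \<beta>\<^sub>1 \<and>
      \<beta>\<^sub>1 < \<beta>\<^sub>2 powr ((real k - 1) / (2 * (real k - 2))) \<longrightarrow>
        nontrivial_exists k \<eta> \<beta>\<^sub>1 \<beta>\<^sub>2 \<and>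
        unstable_on adam_states (adam_step k \<eta> \<beta>\<^sub>1 \<beta>\<^sub>2) (nontrivial_point k \<eta> \<beta>\<^sub>1 \<beta>\<^sub>2)) \<and>
     (\<beta>\<^sub>1 < \<beta>\<^sub>2 powr (real k / (2 * (real k - 2))) \<longrightarrow>
        nontrivial_exists k \<eta> \<beta>\<^sub>1 \<beta>\<^sub>2 \<and>
        asymptotically_stable_on adam_states (adam_step k \<eta> \<beta>\<^sub>1 \<beta>\<^sub>2)
          (nontrivial_point k \<eta> \<beta>\<^sub>1 \<beta>\<^sub>2))"
proof -
  define m where "m = k - 2"
  have k: "k = m + 2" and m: "2 \<le> m" using assms(2) by (auto simp: m_def)
  define s where "s = \<beta>\<^sub>2 powr (1 / (2 * (real k - 2)))"
  interpret adam_params k m \<eta> \<beta>\<^sub>1 \<beta>\<^sub>2 s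
    by unfold_locales (use k m s_def assms in auto)
  have k1: "real k - 1 = real (m + 1)" by (simp add: k)
  have pk1: "\<beta>\<^sub>2 powr ((real k - 1) / (2 * (real k - 2))) = s ^ (m + 1)"
    unfolding k1 by (rule powr_eq_s_power)
  have pk: "\<beta>\<^sub>2 powr (real k / (2 * (real k - 2))) = s ^ (m + 2)"
    using powr_eq_s_power[of k] by (simp add: k)
  \<comment> \<open>The lower bound on \<open>\<beta>\<^sub>2\<close> compares two powers with
    exponent \<open>2 * m\<close>, so it passes to their bases.\<close>
  have "s ^ (2 * m) = \<beta>\<^sub>2"
    using s_power_m \<beta>2 by (simp add: power_even_eq)
  then have "(real m / (real m + 2)) ^ (2 * m) < s ^ (2 * m)"
    using assms(8) by (simp add: k add.commute)
  then have ratio: "real m / (real m + 2) < s"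
    using s_pos by (simp add: power_less_imp_less_base)
  have stable: "nontrivial_exists k \<eta> \<beta>\<^sub>1 \<beta>\<^sub>2 \<and>
      (\<beta>\<^sub>1 < s ^ (m + 2) \<longrightarrow> asymptotically_stable_on adam_states (adam_step k \<eta> \<beta>\<^sub>1 \<beta>\<^sub>2)
         (nontrivial_point k \<eta> \<beta>\<^sub>1 \<beta>\<^sub>2)) \<and>
      (s ^ (m + 2) < \<beta>\<^sub>1 \<longrightarrow> unstable_on adam_states (adam_step k \<eta> \<beta>\<^sub>1 \<beta>\<^sub>2)
         (nontrivial_point k \<eta> \<beta>\<^sub>1 \<beta>\<^sub>2))" if "\<beta>\<^sub>1 < s ^ (m + 1)"
  proof -
    interpret adam_nontrivial k m \<eta> \<beta>\<^sub>1 \<beta>\<^sub>2 s "nontrivial_omega k \<beta>\<^sub>1 \<beta>\<^sub>2"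
      "nontrivial_lambda k \<eta> \<beta>\<^sub>1 \<beta>\<^sub>2" "\<beta>\<^sub>1 / s ^ (m + 2)"
      by unfold_locales (use that in auto)
    show ?thesis
      using nontrivial_exists stability[OF ratio] by (simp add: nontrivial_point_def)
  qed
  \<comment> \<open>The stability threshold lies below the existence threshold, so
    \<open>stable\<close> also applies in the third regime.\<close>
  have "s ^ (m + 2) < s ^ (m + 1)"
    using s_pos s_less_1 by (intro power_strict_decreasing) auto
  then show ?thesis
    unfolding pk1 pk using stable not_nontrivial_exists trivial_fixed_points by fastforce
qed

end
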